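(* Let $d\ge1$. Let $D:\mathbb{Z}^d\to[0,1]$ be a $\mathbb{Z}^d$-symmetric probability distribution that is not supported on a proper sublattice of $\mathbb{Z}^d$, with $\sum_{x}|x|^2D(x)<\infty$. Suppose $D(x)$ has super-exponential decay. For $z\in(0,1)$ let $S_z(x)=\sum_{n=0}^\infty z^nD^{*n}(x)$, which satisfies $S_z=\delta_0+zD*S_z$. Then $S_z$ obeys Assumptions 1 and 2 (stated in the context, with $h=\delta_0$ and $J=zD$) for every $z\in(0,1)$. Moreover, for any $\varepsilon\in(0,1)$ and any $\zeta>0$, there are constants $M,K_{\mathrm{IR}}$ such that $(zD^{(\mu)},\delta_0^{(\mu)})\in\mathcal{Q}_{M,K_{\mathrm{IR}},\zeta}$ uniformly in $\mu\in\overline\Omega_z$ and in $z\in[\varepsilon,1)$.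
   Context: Notation. $|x|=\|x\|_2$ is the Euclidean norm on $\mathbb{R}^d$; $a\wedge b=\min\{a,b\}$; $e_1,\dots,e_d$ is the standard basis; $\delta_0(x)=1$ if $x=0$ and $0$ otherwise; $\mathbb{T}^d$ is the $d$-dimensional torus of period $2\pi$. For $f,g:\mathbb{Z}^d\to\mathbb{R}$: $\hat f(k)=\sum_{x}f(x)e^{-ik\cdot x}$, $(f*g)(x)=\sum_{y}f(x-y)g(y)$, $f^{*n}$ is the $n$-fold convolution ($f^{*0}=\delta_0$), and $\|f(y)\|_p$ is the $\ell^p(\mathbb{Z}^d)$ norm. $f$ is $\mathbb{Z}^d$-symmetric if $f(x)$ is unchanged when a component of $x$ is multiplied by $-1$ or the components of $x$ are permuted. The exponential tilt of $f$ by $\mu\in\mathbb{R}^d$ is $f^{(\mu)}(x)=f(x)e^{\mu\cdot x}$. $D$ has super-exponential decay if for every $a>0$, $D(x)=o(e^{-a|x|})$ as $|x|\to\infty$. Class $\mathcal{Q}_{M,K_{\mathrm{IR}},\zeta}$ (for $d\ge1$, $M,K_{\mathrm{IR}},\zeta>0$): the set of pairs $(Q,g)$ of functions $\mathbb{Z}^d\to\mathbb{R}$ such that (a) $\|Q(y)\|_1\le M$ and $\||y|^{2+\zeta}Q(y)\|_1\le M$; (b) $\mathrm{Re}[\hat Q(0)-\hat Q(k)]\ge K_{\mathrm{IR}}|k|^2$ for $k\in\mathbb{T}^d$ (represented in $[-\pi,\pi]^d$); (c) $\|g(y)\|_1\le M$, $\||y|^{\zeta}g(y)\|_1\le M$,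 $\||y|^2g(y)\|_{p_d\wedge2}\le M$, where $p_d=2$ for $d=1$ and $p_d=\frac{d}{d-2+(\zeta\wedge2)}$ for $d\ge2$; (d) if $d\ge4$, additionally $\||y|^{d-1}Q(y)\|_{\frac d3\wedge2}\le M$ and $\||y|^{d-1}g(y)\|_2\le M$. For $S:\mathbb{Z}^d\to[0,\infty)$ let $\chi^{(\mu)}=\sum_{x}S^{(\mu)}(x)$ and $\Omega=\{\mu\in\mathbb{R}^d:\chi^{(\mu)}<\infty\}$, with closure $\overline\Omega$; for $S=S_z$ these are written $\chi^{(\mu)}(z)$, $\Omega_z$, $\overline\Omega_z$. Assumption 1: $S$ is $\mathbb{Z}^d$-symmetric, $\Omega$ is an open set containing $0$, and $\mu_1e_1\notin\Omega$ for some $\mu_1>0$. Assumption 2: $S=h+J*S$ with $\mathbb{Z}^d$-symmetric $J,h\in\ell^1(\mathbb{Z}^d)$, and there are $M,K_{\mathrm{IR}},\zeta>0$ such that for every $\mu\in\overline\Omega$ (with the same constants for all $\mu$) $(J^{(\mu)},h^{(\mu)})\in\mathcal{Q}_{M,K_{\mathrm{IR}},\zeta}$ and $\hat h^{(\mu)}(0)>0$. *)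

theory Defs
  imports "HOL-Analysis.Analysis" "HOL-Library.Landau_Symbols"
begin

text \<open>
  The lattice \<open>\<int>\<^sup>d\<close> is the type \<^typ>\<open>int ^ 'd\<close> over a finite index type, with \<open>d = CARD('d)\<close>,
  which is at least 1 because types are nonempty.
\<close>

definition lat :: "int ^ 'd \<Rightarrow> real ^ 'd::finite" where
  "lat x = (\<chi> i. real_of_int (x $ i))"

definition lnorm :: "int ^ 'd \<Rightarrow> real" where
  "lnorm x = norm (lat (x :: int ^ 'd::finite))"

definition delta0 :: "int ^ 'd \<Rightarrow> real" where
  "delta0 x = (if x = (0 :: int ^ 'd::finite) then 1 else 0)"

definition fourier :: "(int ^ 'd \<Rightarrow> real) \<Rightarrow> real ^ 'd::finite \<Rightarrow> complex" where
  "fourier f k = (\<Sum>\<^sub>\<infinity>x. complex_of_real (f x) * exp (- (\<i> * complex_of_real (k \<bullet> lat x))))"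

definition convol :: "(int ^ 'd \<Rightarrow> real) \<Rightarrow> (int ^ 'd \<Rightarrow> real) \<Rightarrow> int ^ 'd::finite \<Rightarrow> real" where
  "convol f g x = (\<Sum>\<^sub>\<infinity>y. f (x - y) * g y)"

primrec convol_pow :: "(int ^ 'd \<Rightarrow> real) \<Rightarrow> nat \<Rightarrow> int ^ 'd::finite \<Rightarrow> real" where
  "convol_pow f 0 = delta0"
| "convol_pow f (Suc n) = convol f (convol_pow f n)"

definition lat_symmetric :: "(int ^ 'd::finite \<Rightarrow> real) \<Rightarrow> bool" where
  "lat_symmetric f \<longleftrightarrow>
     (\<forall>x i. f (\<chi> j. if j = i then - (x $ j) else x $ j) = f x) \<and>
     (\<forall>x p. p permutes UNIV \<longrightarrow> f (\<chi> j. x $ p j) = f x)"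

definition tilt :: "real ^ 'd \<Rightarrow> (int ^ 'd \<Rightarrow> real) \<Rightarrow> int ^ 'd::finite \<Rightarrow> real" where
  "tilt \<mu> f x = f x * exp (\<mu> \<bullet> lat x)"

definition superexp_decay :: "(int ^ 'd::finite \<Rightarrow> real) \<Rightarrow> bool" where
  "superexp_decay D \<longleftrightarrow> (\<forall>a>0. D \<in> o[filtercomap lnorm at_top](\<lambda>x. exp (- a * lnorm x)))"

definition prob_distribution :: "(int ^ 'd::finite \<Rightarrow> real) \<Rightarrow> bool" where
  "prob_distribution D \<longleftrightarrow> (\<forall>x. 0 \<le> D x \<and> D x \<le> 1) \<and> (D has_sum 1) UNIV"

text \<open>
  A sublattice is an additive subgroup. No rank condition is imposed: every proper subgroup of
  \<open>\<int>\<^sup>d\<close> is contained in a proper subgroup of full rank, so requiring full rank would not change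
  which functions are supported on a proper sublattice.
\<close>

definition sublattice :: "(int ^ 'd::finite) set \<Rightarrow> bool" where
  "sublattice L \<longleftrightarrow> 0 \<in> L \<and> (\<forall>x\<in>L. \<forall>y\<in>L. x - y \<in> L)"

definition supported_on_proper_sublattice :: "(int ^ 'd::finite \<Rightarrow> real) \<Rightarrow> bool" where
  "supported_on_proper_sublattice D \<longleftrightarrow>
     (\<exists>L. sublattice L \<and> L \<noteq> UNIV \<and> {x. D x \<noteq> 0} \<subseteq> L)"

definition in_lp :: "real \<Rightarrow> ('a \<Rightarrow> real) \<Rightarrow> bool" where
  "in_lp p f \<longleftrightarrow> (\<lambda>y. \<bar>f y\<bar> powr p) summable_on UNIV"

definition lp_norm :: "real \<Rightarrow> ('a \<Rightarrow> real) \<Rightarrow> real" where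
  "lp_norm p f = (\<Sum>\<^sub>\<infinity>y. \<bar>f y\<bar> powr p) powr (1 / p)"

text \<open>
  Since \<^const>\<open>lp_norm\<close> is 0 for a divergent sum, a norm bound also has to state membership in
  \<open>\<ell>\<^sup>p\<close>.
\<close>

definition lp_norm_le :: "real \<Rightarrow> ('a \<Rightarrow> real) \<Rightarrow> real \<Rightarrow> bool" where
  "lp_norm_le p f M \<longleftrightarrow> in_lp p f \<and> lp_norm p f \<le> M"

definition p_exponent :: "nat \<Rightarrow> real \<Rightarrow> real" where
  "p_exponent d \<zeta> = (if d = 1 then 2 else real d / (real d - 2 + min \<zeta> 2))"

definition class_Q ::
  "real \<Rightarrow> real \<Rightarrow> real \<Rightarrow> ((int ^ 'd::finite \<Rightarrow> real) \<times> (int ^ 'd \<Rightarrow> real)) set" where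
  "class_Q M K \<zeta> = {(Q, g).
     lp_norm_le 1 Q M \<and>
     lp_norm_le 1 (\<lambda>y. lnorm y powr (2 + \<zeta>) * Q y) M \<and>
     (\<forall>k :: real ^ 'd. (\<forall>i. \<bar>k $ i\<bar> \<le> pi) \<longrightarrow>
        Re (fourier Q 0 - fourier Q k) \<ge> K * (norm k)\<^sup>2) \<and>
     lp_norm_le 1 g M \<and>
     lp_norm_le 1 (\<lambda>y. lnorm y powr \<zeta> * g y) M \<and>
     lp_norm_le (min (p_exponent CARD('d) \<zeta>) 2) (\<lambda>y. (lnorm y)\<^sup>2 * g y) M \<and>
     (CARD('d) \<ge> 4 \<longrightarrow>
        lp_norm_le (min (real CARD('d) / 3) 2) (\<lambda>y. lnorm y ^ (CARD('d) - 1) * Q y) M \<and>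
        lp_norm_le 2 (\<lambda>y. lnorm y ^ (CARD('d) - 1) * g y) M)}"

definition chi :: "(int ^ 'd \<Rightarrow> real) \<Rightarrow> real ^ 'd::finite \<Rightarrow> ennreal" where
  "chi S \<mu> = (\<Sum>\<^sub>\<infinity>x. ennreal (tilt \<mu> S x))"

definition Omega :: "(int ^ 'd \<Rightarrow> real) \<Rightarrow> (real ^ 'd::finite) set" where
  "Omega S = {\<mu>. chi S \<mu> < \<infinity>}"

text \<open>
  Nonnegativity of \<open>S\<close> is part of the first assumption because \<^const>\<open>chi\<close> discards negative
  values.
\<close>

definition assumption1 :: "(int ^ 'd::finite \<Rightarrow> real) \<Rightarrow> bool" where
  "assumption1 S \<longleftrightarrow>
     (\<forall>x. 0 \<le> S x) \<and> lat_symmetric S \<and> open (Omega S) \<and> 0 \<in> Omega S \<and>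
     (\<exists>\<mu>\<^sub>1>0. \<forall>i. axis i \<mu>\<^sub>1 \<notin> Omega S)"

text \<open>
  The index type has no distinguished first element, so the condition on \<open>\<mu>\<^sub>1 e\<^sub>1\<close> is stated for
  every coordinate direction; for symmetric \<open>S\<close> these are all equivalent. The Fourier transform at
  0 is a real number, hence the real part in the positivity condition below.
\<close>

definition assumption2 ::
  "(int ^ 'd::finite \<Rightarrow> real) \<Rightarrow> (int ^ 'd \<Rightarrow> real) \<Rightarrow> (int ^ 'd \<Rightarrow> real) \<Rightarrow> bool" where
  "assumption2 S h J \<longleftrightarrow>
     (\<forall>x. S x = h x + convol J S x) \<and>
     lat_symmetric J \<and> lat_symmetric h \<and> in_lp 1 J \<and> in_lp 1 h \<and>
     (\<exists>M>0. \<exists>K>0. \<exists>\<zeta>>0. \<forall>\<mu>\<in>closure (Omega S).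
        (tilt \<mu> J, tilt \<mu> h) \<in> class_Q M K \<zeta> \<and> Re (fourier (tilt \<mu> h) 0) > 0)"

definition green :: "(int ^ 'd \<Rightarrow> real) \<Rightarrow> real \<Rightarrow> int ^ 'd::finite \<Rightarrow> real" where
  "green D z x = (\<Sum>n. z ^ n * convol_pow D n x)"

end

theory Submission
  imports Defs
begin

text \<open>
  Convolution multiplies total masses and commutes with tilting, so with \<open>\<phi> \<mu> = \<Sum>x. D x exp (\<mu> \<bullet> x)\<close>
  the renewal equation gives \<open>\<Omega>\<^sub>z = {\<mu>. z \<phi> \<mu> < 1}\<close>. The function \<open>\<phi>\<close> is finite and convex,
  hence continuous, and symmetry makes it coercive: reflecting the coordinates of a support point
  to match the signs of \<open>\<mu>\<close> bounds \<open>\<phi> \<mu>\<close> below by a multiple of \<open>exp \<bar>\<mu>\<^sub>i\<bar>\<close>. So for \<open>z \<ge> \<epsilon>\<close> all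
  \<open>\<Omega>\<^sub>z\<close> lie in one ball of radius \<open>R\<close>, on which the moment bounds follow from super-exponential decay.

  The tilted walk dominates the single weight \<open>w x = D x exp (- R \<bar>x\<bar>)\<close>, so the infrared bound is
  needed for \<open>w\<close> only. With \<open>G k = \<Sum>x. w x (1 - cos (k \<bullet> x))\<close>, subadditivity of \<open>\<bar>sin\<bar>\<close> shows that
  the points \<open>x\<close> for which \<open>\<bar>sin (k \<bullet> x / 2)\<bar> \<le> C sqrt (G k)\<close> for some \<open>C\<close> and all \<open>k\<close> form a
  sublattice containing the support; it is therefore everything, and contains the unit vectors.
\<close>

subsection \<open>Convolution, tilting and symmetry\<close>

lemma convol_nonneg:
  assumes "\<And>x. 0 \<le> f x" and "\<And>x. 0 \<le> g x"
  shows "0 \<le> convol f g x"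
  unfolding convol_def by (intro infsum_nonneg mult_nonneg_nonneg assms)

text \<open>The shear \<open>(x, y) \<mapsto> (y, x - y)\<close> turns the double sum into a product
  of two independent sums; nonnegativity supplies the joint summability needed to exchange the order
  of summation.\<close>

lemma has_sum_convol:
  fixes f g :: "int ^ 'd::finite \<Rightarrow> real"
  assumes f0: "\<And>x. 0 \<le> f x" and g0: "\<And>x. 0 \<le> g x"
    and fa: "(f has_sum a) UNIV" and gb: "(g has_sum b) UNIV"
  shows "(convol f g has_sum (a * b)) UNIV"
proof -
  have inner: "((\<lambda>u. f u * g y) has_sum (a * g y)) UNIV" for y
    by (intro has_sum_cmult_left fa)
  have outer: "((\<lambda>y. a * g y) has_sum (a * b)) UNIV"
    by (intro has_sum_cmult_right gb)
  have "(\<lambda>(y, u). f u * g y) summable_on UNIV \<times> UNIV"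
    by (rule summable_on_SigmaI[where g = "\<lambda>y. a * g y"])
      (use inner outer f0 g0 in \<open>auto simp: has_sum_imp_summable\<close>)
  then have "((\<lambda>(y, u). f u * g y) has_sum (a * b)) (UNIV \<times> UNIV)"
    by (intro has_sum_SigmaI[where g = "\<lambda>y. a * g y"]) (use inner outer in auto)
  then have *: "((\<lambda>(x, y). f (x - y) * g y) has_sum (a * b)) (UNIV \<times> UNIV)"
    by (subst has_sum_reindex_bij_witness
        [where i = "\<lambda>(y, u). (u + y, y)" and j = "\<lambda>(x, y). (y, x - y)"
          and T = "UNIV \<times> UNIV" and h = "\<lambda>(y, u). f u * g y"]) auto
  have row: "(\<lambda>y. f (x - y) * g y) summable_on UNIV" for x
    using summable_on_SigmaD1[of "\<lambda>x y. f (x - y) * g y" UNIV "\<lambda>_. UNIV" x]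
      has_sum_imp_summable[OF *] by auto
  have "((\<lambda>x. \<Sum>\<^sub>\<infinity>y. f (x - y) * g y) has_sum (a * b)) UNIV"
    by (rule has_sum_SigmaD[OF *]) (use row in auto)
  then show "(convol f g has_sum (a * b)) UNIV"
    by (simp add: convol_def[abs_def])
qed

lemma has_sum_delta0: "((delta0 :: int ^ 'd::finite \<Rightarrow> real) has_sum 1) UNIV"
  by (rule has_sum_finite_neutralI[of "{0}"]) (auto simp: delta0_def)

lemma delta0_nonneg: "0 \<le> delta0 x"
  by (simp add: delta0_def)

lemma convol_pow_nonneg:
  assumes "\<And>x. 0 \<le> f x"
  shows "0 \<le> convol_pow f n x"
  by (induction n arbitrary: x) (auto simp: delta0_nonneg intro!: convol_nonneg assms)

lemma has_sum_convol_pow: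
  assumes "\<And>x. 0 \<le> f x" and "(f has_sum a) UNIV"
  shows "(convol_pow f n has_sum (a ^ n)) UNIV"
  by (induction n) (auto simp: has_sum_delta0 intro!: has_sum_convol convol_pow_nonneg assms)

section \<open>Exponential tilts\<close>

lemma lat_simps: "lat (x - y) = lat x - lat y" "lat (x + y) = lat x + lat y" "lat 0 = 0"
  by (auto simp: lat_def vec_eq_iff)

lemma lnorm_nonneg [simp]: "0 \<le> lnorm x"
  by (simp add: lnorm_def)

lemma lnorm_zero [simp]: "lnorm 0 = 0"
  by (simp add: lnorm_def lat_simps)

lemma tilt_nonneg: "0 \<le> f x \<Longrightarrow> 0 \<le> tilt \<mu> f x"
  by (simp add: tilt_def)

lemma tilt_delta0 [simp]: "tilt \<mu> delta0 = delta0"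
  by (auto simp: tilt_def delta0_def lat_simps)

lemma tilt_cmult: "tilt \<mu> (\<lambda>x. c * f x) x = c * tilt \<mu> f x"
  by (simp add: tilt_def)

text \<open>The exponential is a character: \<open>exp (\<mu> \<bullet> lat x)\<close> factors over
  \<open>x = (x - y) + y\<close> and is constant in the summation variable.\<close>

lemma tilt_convol: "tilt \<mu> (convol f g) = convol (tilt \<mu> f) (tilt \<mu> g)"
proof
  fix x
  have "convol (tilt \<mu> f) (tilt \<mu> g) x = (\<Sum>\<^sub>\<infinity>y. f (x - y) * g y * exp (\<mu> \<bullet> lat x))"
    unfolding convol_def tilt_def
    by (intro infsum_cong) (simp add: lat_simps inner_diff_right exp_diff)
  then show "tilt \<mu> (convol f g) x = convol (tilt \<mu> f) (tilt \<mu> g) x"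
    by (simp add: infsum_cmult_left' convol_def tilt_def)
qed

lemma tilt_convol_pow: "tilt \<mu> (convol_pow f n) = convol_pow (tilt \<mu> f) n"
  by (induction n) (simp_all add: tilt_convol)

section \<open>Invariance under the lattice symmetries\<close>

lemma convol_invariant:
  fixes T :: "int ^ 'd::finite \<Rightarrow> int ^ 'd"
  assumes "bij T" and "\<And>x y. T (x - y) = T x - T y"
    and "\<And>x. f (T x) = f x" and "\<And>x. g (T x) = g x"
  shows "convol f g (T x) = convol f g x"
proof -
  have "convol f g (T x) = (\<Sum>\<^sub>\<infinity>y. f (T x - T y) * g (T y))"
    unfolding convol_def using infsum_reindex_bij_betw[OF assms(1), of "\<lambda>y. f (T x - y) * g y"]
    by simp
  also have "\<dots> = convol f g x"
    unfolding convol_def by (simp flip: assms(2) add: assms(3,4))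
  finally show ?thesis .
qed

text \<open>Sign flips and coordinate permutations are both additive bijections of the lattice, so
  the two clauses of \<open>lat_symmetric\<close> can be treated by one argument about an abstract
  such map \<open>T\<close>.\<close>

lemma lat_symmetric_transfer:
  fixes f g h :: "int ^ 'd::finite \<Rightarrow> real"
  assumes "lat_symmetric f" "lat_symmetric g"
    and transfer: "\<And>T x. bij T \<Longrightarrow> (\<And>x y. T (x - y) = T x - T y) \<Longrightarrow>
      (\<And>x. f (T x) = f x) \<Longrightarrow> (\<And>x. g (T x) = g x) \<Longrightarrow> h (T x) = h x"
  shows "lat_symmetric h"
  unfolding lat_symmetric_def
proof (intro conjI allI impI)
  fix x :: "int ^ 'd" and i
  let ?T = "\<lambda>x :: int ^ 'd. \<chi> j. if j = i then - (x $ j) else x $ j"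
  have "bij ?T"
    by (rule o_bij[of ?T ?T]) (auto simp: fun_eq_iff vec_eq_iff)
  then show "h (?T x) = h x"
    by (rule transfer) (use assms(1,2) in \<open>auto simp: lat_symmetric_def vec_eq_iff\<close>)
next
  fix x :: "int ^ 'd" and p :: "'d \<Rightarrow> 'd"
  assume p: "p permutes UNIV"
  let ?T = "\<lambda>x :: int ^ 'd. \<chi> j. x $ p j"
  have "bij ?T"
    by (rule o_bij[of "\<lambda>x. \<chi> j. x $ inv p j"])
      (auto simp: fun_eq_iff vec_eq_iff permutes_inverses[OF p])
  then show "h (?T x) = h x"
    by (rule transfer) (use assms(1,2) p in \<open>auto simp: lat_symmetric_def vec_eq_iff\<close>)
qed

lemma lat_symmetric_convol:
  assumes "lat_symmetric f" "lat_symmetric g"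
  shows "lat_symmetric (convol f g)"
  using assms by (rule lat_symmetric_transfer) (rule convol_invariant)

lemma lat_symmetric_delta0: "lat_symmetric (delta0 :: int ^ 'd::finite \<Rightarrow> real)"
  unfolding lat_symmetric_def
proof (intro conjI allI impI)
  fix x :: "int ^ 'd" and p :: "'d \<Rightarrow> 'd"
  assume p: "p permutes UNIV"
  have "(\<forall>i. x $ p i = 0) \<longleftrightarrow> (\<forall>i. x $ i = 0)"
    by (metis p permutes_inverses(1))
  then show "delta0 (\<chi> j. x $ p j) = delta0 x"
    by (simp add: delta0_def vec_eq_iff)
qed (simp add: delta0_def vec_eq_iff, metis)

lemma lat_symmetric_convol_pow:
  "lat_symmetric f \<Longrightarrow> lat_symmetric (convol_pow f n)"
  by (induction n) (auto simp: lat_symmetric_delta0 lat_symmetric_convol)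

lemma lat_symmetric_green:
  "lat_symmetric D \<Longrightarrow> lat_symmetric (green D z)"
  using lat_symmetric_convol_pow[of D]
  by (simp add: lat_symmetric_def green_def)

text \<open>Passes from the extended-real susceptibility to real summability: for nonnegative terms
  both mean that the finite partial sums are bounded.\<close>

lemma chi_finite_iff:
  assumes "\<And>x. 0 \<le> S x"
  shows "chi S \<mu> < \<infinity> \<longleftrightarrow> tilt \<mu> S summable_on UNIV"
proof
  have nn: "0 \<le> tilt \<mu> S x" for x by (simp add: tilt_nonneg assms)
  {
    assume "chi S \<mu> < \<infinity>"
    moreover have "ennreal (sum (tilt \<mu> S) F) \<le> chi S \<mu>" if "finite F" for F
    proof -
      have "ennreal (sum (tilt \<mu> S) F) = (\<Sum>x\<in>F. ennreal (tilt \<mu> S x))"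
        by (simp add: nn)
      also have "\<dots> \<le> chi S \<mu>"
        unfolding chi_def by (subst nonneg_infsum_complete) (use that in \<open>auto intro!: SUP_upper\<close>)
      finally show ?thesis .
    qed
    ultimately have "sum (tilt \<mu> S) F \<le> enn2real (chi S \<mu>)" if "finite F" for F
      using that by (metis ennreal_le_iff ennreal_enn2real enn2real_nonneg infinity_ennreal_def)
    then show "tilt \<mu> S summable_on UNIV"
      by (intro nonneg_bdd_above_summable_on bdd_aboveI2[of _ _ "enn2real (chi S \<mu>)"])
        (auto simp: nn)
  }
  assume "tilt \<mu> S summable_on UNIV"
  then have "chi S \<mu> = ennreal (infsum (tilt \<mu> S) UNIV)"
    unfolding chi_def
    by (subst infsum_nonneg_is_SUPREMUM_ennreal; (subst nonneg_infsum_complete)?)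
      (auto simp: nn intro!: SUP_cong)
  then show "chi S \<mu> < \<infinity>" by simp
qed

subsection \<open>Exponential summability on the lattice\<close>

lemma summable_on_exp_abs_int:
  fixes a :: real
  assumes "0 < a"
  shows "(\<lambda>m::int. exp (- a * \<bar>real_of_int m\<bar>)) summable_on UNIV"
proof -
  have "summable (\<lambda>n. exp (- a) ^ n)"
    by (rule summable_geometric) (use assms in simp)
  moreover have exp_pow: "exp (- a) ^ n = exp (- a * real n)" for n
    by (simp add: exp_of_nat_mult[symmetric] mult.commute)
  ultimately have nat: "(\<lambda>n. exp (- a * real n)) summable_on UNIV"
    by (simp add: summable_on_UNIV_nonneg_real_iff)
  have "(\<lambda>m. exp (- a * \<bar>real_of_int m\<bar>)) summable_on range int"
    by (subst summable_on_reindex) (use nat in \<open>simp_all add: o_def\<close>)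
  moreover have "(\<lambda>m. exp (- a * \<bar>real_of_int m\<bar>)) summable_on range (\<lambda>n. - int n)"
    by (subst summable_on_reindex) (use nat in \<open>simp_all add: o_def inj_def\<close>)
  ultimately have "(\<lambda>m. exp (- a * \<bar>real_of_int m\<bar>)) summable_on
      (range int \<union> range (\<lambda>n. - int n))"
    by (rule summable_on_union)
  moreover have "m \<in> range int \<union> range (\<lambda>n. - int n)" for m
    by (cases m rule: int_cases2) auto
  ultimately show ?thesis
    by (metis UNIV_eq_I)
qed

text \<open>The Euclidean norm dominates the l1 norm divided by the dimension, so the weight is at
  most a product of one-dimensional exponentials, each summable over the integers.\<close>

lemma summable_on_exp_lnorm:
  fixes a :: real
  assumes "0 < a"
  shows "(\<lambda>x :: int ^ 'd::finite. exp (- a * lnorm x)) summable_on UNIV"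
proof -
  define b where "b = a / CARD('d)"
  have b: "0 < b" using assms by (simp add: b_def)
  define T where "T = (\<Sum>\<^sub>\<infinity>m::int. exp (- b * \<bar>real_of_int m\<bar>))"
  let ?P = "\<lambda>x :: int ^ 'd. \<Prod>i\<in>UNIV. exp (- b * \<bar>real_of_int (x $ i)\<bar>)"
  have le: "exp (- a * lnorm x) \<le> ?P x" for x :: "int ^ 'd"
  proof -
    have "(\<Sum>i\<in>UNIV. \<bar>real_of_int (x $ i)\<bar>) \<le> (\<Sum>i\<in>(UNIV :: 'd set). lnorm x)"
      using component_le_norm_cart[of "lat x"]
      by (intro sum_mono) (simp add: lnorm_def lat_def)
    then have "b * (\<Sum>i\<in>UNIV. \<bar>real_of_int (x $ i)\<bar>) \<le> b * (CARD('d) * lnorm x)"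
      using b by simp
    also have "\<dots> = a * lnorm x" by (simp add: b_def)
    finally show ?thesis
      by (simp add: exp_sum[symmetric] sum_distrib_left sum_negf)
  qed
  have bound: "sum ?P F \<le> T ^ CARD('d)" if "finite F" for F
  proof -
    \<comment> \<open>Coordinate projections of \<open>F\<close>: the finite set lies in the box
      that they span, and over a box the sum of products is a product of sums.\<close>
    define B where "B = (\<lambda>i. (\<lambda>x :: int ^ 'd. x $ i) ` F)"
    have B: "finite (B i)" for i by (simp add: B_def that)
    have "sum ?P F = (\<Sum>g\<in>vec_nth ` F. \<Prod>i\<in>UNIV. exp (- b * \<bar>real_of_int (g i)\<bar>))"
      by (subst sum.reindex) (auto simp: inj_on_def vec_nth_inject)
    also have "\<dots> \<le> (\<Sum>g\<in>PiE UNIV B. \<Prod>i\<in>UNIV. exp (- b * \<bar>real_of_int (g i)\<bar>))"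
      by (intro sum_mono2) (auto simp: B B_def intro!: finite_PiE prod_nonneg that)
    also have "\<dots> = (\<Prod>i\<in>UNIV. \<Sum>m\<in>B i. exp (- b * \<bar>real_of_int m\<bar>))"
      by (rule prod_sum_PiE[symmetric]) (auto simp: B)
    also have "\<dots> \<le> (\<Prod>i\<in>(UNIV :: 'd set). T)"
      unfolding T_def
      by (intro prod_mono conjI sum_nonneg finite_sum_le_infsum summable_on_exp_abs_int B b) auto
    finally show ?thesis by simp
  qed
  have "?P summable_on UNIV"
    by (intro nonneg_bdd_above_summable_on bdd_aboveI2[of _ _ "T ^ CARD('d)"])
      (use bound in \<open>auto intro: prod_nonneg\<close>)
  then show ?thesis
    by (rule summable_on_comparison_test) (use le in auto)
qed

text \<open>The little-o condition only controls \<open>D\<close> outside a ball of radius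
  \<open>N\<close>; inside it \<open>D \<le> 1\<close>, and the constant
  \<open>exp (a * max N 0)\<close> compensates for the exponential.\<close>

lemma superexp_decay_bound:
  fixes D :: "int ^ 'd::finite \<Rightarrow> real"
  assumes "superexp_decay D" and D: "\<And>x. 0 \<le> D x \<and> D x \<le> 1" and "0 < a"
  obtains C where "0 \<le> C" "\<And>x. D x \<le> C * exp (- a * lnorm x)"
proof -
  have "D \<in> o[filtercomap lnorm at_top](\<lambda>x. exp (- a * lnorm x))"
    using assms by (simp add: superexp_decay_def)
  then have "\<forall>\<^sub>F x in filtercomap lnorm at_top. norm (D x) \<le> 1 * norm (exp (- a * lnorm x))"
    by (rule landau_o.smallD) simp
  then obtain N where N: "\<And>x. N \<le> lnorm x \<Longrightarrow> D x \<le> exp (- a * lnorm x)"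
    by (auto simp: eventually_filtercomap eventually_at_top_linorder D)
  have "D x \<le> exp (a * max N 0) * exp (- a * lnorm x)" for x
  proof (cases "N \<le> lnorm x")
    case True
    have "1 * exp (- a * lnorm x) \<le> exp (a * max N 0) * exp (- a * lnorm x)"
      by (intro mult_right_mono) (use \<open>0 < a\<close> in auto)
    with N[OF True] show ?thesis by linarith
  next
    case False
    then have "a * lnorm x \<le> a * max N 0" using \<open>0 < a\<close> by simp
    then have "1 \<le> exp (a * max N 0) * exp (- a * lnorm x)"
      by (simp flip: exp_add)
    with D[of x] show ?thesis by linarith
  qed
  then show thesis by (intro that[of "exp (a * max N 0)"]) auto
qed

lemma tilt_exp_bound:
  assumes "norm \<mu> \<le> R"
  shows "exp (- R * lnorm x) \<le> exp (\<mu> \<bullet> lat x)" "exp (\<mu> \<bullet> lat x) \<le> exp (R * lnorm x)"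
proof -
  have "\<bar>\<mu> \<bullet> lat x\<bar> \<le> norm \<mu> * lnorm x"
    unfolding lnorm_def by (rule Cauchy_Schwarz_ineq2)
  also have "\<dots> \<le> R * lnorm x" by (intro mult_right_mono assms) simp
  finally show "exp (- R * lnorm x) \<le> exp (\<mu> \<bullet> lat x)" "exp (\<mu> \<bullet> lat x) \<le> exp (R * lnorm x)"
    by simp_all
qed

lemma summable_on_tilt:
  assumes "superexp_decay D" and "\<And>x. 0 \<le> D x \<and> D x \<le> 1"
  shows "tilt \<mu> D summable_on UNIV"
proof -
  \<comment> \<open>The tilt costs at most the rate \<open>norm \<mu>\<close>; the extra 1 remains
    as a summable exponential.\<close>
  obtain C where C: "0 \<le> C" "\<And>x. D x \<le> C * exp (- (norm \<mu> + 1) * lnorm x)"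
    by (rule superexp_decay_bound[OF assms, of "norm \<mu> + 1"]) (auto simp: add_nonneg_pos)
  have "tilt \<mu> D x \<le> C * exp (- 1 * lnorm x)" for x
  proof -
    have "tilt \<mu> D x \<le> C * exp (- (norm \<mu> + 1) * lnorm x) * exp (norm \<mu> * lnorm x)"
      unfolding tilt_def using C assms(2) tilt_exp_bound(2)[of \<mu> "norm \<mu>" x]
      by (intro mult_mono) auto
    then show ?thesis by (simp add: mult.assoc algebra_simps flip: exp_add)
  qed
  then show ?thesis
    by (intro summable_on_comparison_test
          [OF summable_on_cmult_right[OF summable_on_exp_lnorm[of 1]]])
      (auto intro: tilt_nonneg simp: assms(2))
qed

section \<open>Uniform bounds on weighted lp norms\<close>

lemma lp_norm_le_mono:
  assumes "lp_norm_le p f M" and "M \<le> M'"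
  shows "lp_norm_le p f M'"
  using assms by (auto simp: lp_norm_le_def)

lemma lp_norm_le_zero: "0 \<le> M \<Longrightarrow> lp_norm_le p (\<lambda>_. 0) M"
  by (simp add: lp_norm_le_def in_lp_def lp_norm_def)

text \<open>The bound depends on \<open>f\<close> only through \<open>C\<close>, so one constant
  serves every family dominated by the same exponential.\<close>

lemma lp_norm_le_exp_bound:
  fixes f :: "int ^ 'd::finite \<Rightarrow> real"
  assumes p: "0 < p" and "0 \<le> C" and f: "\<And>x. \<bar>f x\<bar> \<le> C * exp (- lnorm x)"
  shows "lp_norm_le p f ((\<Sum>\<^sub>\<infinity>x :: int ^ 'd. C powr p * exp (- p * lnorm x)) powr (1 / p))"
proof -
  have le: "\<bar>f x\<bar> powr p \<le> C powr p * exp (- p * lnorm x)" for x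
  proof -
    have "\<bar>f x\<bar> powr p \<le> (C * exp (- lnorm x)) powr p"
      by (intro powr_mono2) (use p f in auto)
    also have "\<dots> = C powr p * exp (- p * lnorm x)"
      using \<open>0 \<le> C\<close> by (simp add: powr_mult exp_powr_real mult.commute)
    finally show ?thesis .
  qed
  have sum: "(\<lambda>x :: int ^ 'd. C powr p * exp (- p * lnorm x)) summable_on UNIV"
    by (intro summable_on_cmult_right summable_on_exp_lnorm p)
  then have in_lp: "(\<lambda>x. \<bar>f x\<bar> powr p) summable_on UNIV"
    by (rule summable_on_comparison_test) (use le in auto)
  then show ?thesis
    unfolding lp_norm_le_def in_lp_def lp_norm_def
    using sum le p by (auto intro!: powr_mono2 infsum_nonneg infsum_mono)
qed

text \<open>Source of all moment bounds on the tilted step distribution: \<open>M\<close> is fixed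
  before \<open>z\<close> and \<open>\<mu>\<close>, which gives uniformity over the ball of radius
  \<open>R\<close>.\<close>

lemma tilt_weighted_bound:
  fixes D w :: "int ^ 'd::finite \<Rightarrow> real"
  assumes "superexp_decay D" and D: "\<And>x. 0 \<le> D x \<and> D x \<le> 1" and "0 < p"
    and w: "\<And>x. 0 \<le> w x" "\<And>x. w x \<le> A * exp (lnorm x)"
  obtains M where "\<And>z \<mu>. 0 \<le> z \<Longrightarrow> z \<le> 1 \<Longrightarrow> norm \<mu> \<le> R \<Longrightarrow>
    lp_norm_le p (\<lambda>x. w x * (z * tilt \<mu> D x)) M"
proof -
  have "0 \<le> A" using w[of 0] by simp
  \<comment> \<open>Of the rate \<open>\<bar>R\<bar> + 2\<close>, the part
    \<open>\<bar>R\<bar>\<close> absorbs the tilt, 1 absorbs the growth of \<open>w\<close>, and 1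
    is left for summability. The absolute value keeps the rate positive for any sign of
    \<open>R\<close>.\<close>
  obtain C where C: "0 \<le> C" "\<And>x. D x \<le> C * exp (- (\<bar>R\<bar> + 2) * lnorm x)"
    by (rule superexp_decay_bound[OF assms(1) D, of "\<bar>R\<bar> + 2"]) auto
  have "\<bar>w x * (z * tilt \<mu> D x)\<bar> \<le> (A * C) * exp (- lnorm x)"
    if "0 \<le> z" "z \<le> 1" "norm \<mu> \<le> R" for z \<mu> x
  proof -
    have nonneg: "0 \<le> tilt \<mu> D x" by (simp add: D tilt_nonneg)
    have "tilt \<mu> D x \<le> C * exp (- (\<bar>R\<bar> + 2) * lnorm x) * exp (\<bar>R\<bar> * lnorm x)"
      unfolding tilt_def using C D tilt_exp_bound(2)[of \<mu> "\<bar>R\<bar>" x] that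
      by (intro mult_mono) auto
    also have "\<dots> = C * exp (- 2 * lnorm x)"
      by (simp add: mult.assoc algebra_simps flip: exp_add)
    finally have "z * tilt \<mu> D x \<le> C * exp (- 2 * lnorm x)"
      using mult_right_mono[OF that(2) nonneg] by simp
    then have "w x * (z * tilt \<mu> D x) \<le> (A * exp (lnorm x)) * (C * exp (- 2 * lnorm x))"
      by (rule mult_mono[OF w(2)]) (use \<open>0 \<le> A\<close> nonneg that in simp_all)
    also have "\<dots> = (A * C) * exp (- lnorm x)"
      by (simp add: mult.assoc mult.left_commute flip: exp_add)
    finally show ?thesis using w nonneg that by simp
  qed
  then show thesis
    by (intro that[OF lp_norm_le_exp_bound[OF \<open>0 < p\<close>, of "A * C"]]) (use C \<open>0 \<le> A\<close> in auto)
qed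

text \<open>One term of the exponential series is at most the whole series.\<close>

lemma power_le_fact_exp:
  fixes t :: real
  assumes "0 \<le> t"
  shows "t ^ n \<le> fact n * exp t"
proof -
  have "t ^ n / fact n = (\<Sum>k\<in>{n}. inverse (fact k) *\<^sub>R t ^ k)"
    by (simp add: field_simps)
  also have "\<dots> \<le> exp t"
    unfolding exp_def by (intro sum_le_suminf summable_exp_generic) (use assms in auto)
  finally show ?thesis by (simp add: field_simps)
qed

lemma powr_le_exp:
  fixes q :: real
  assumes "0 \<le> q"
  obtains A where "\<And>t. 0 \<le> t \<Longrightarrow> t powr q \<le> A * exp t"
proof
  fix t :: real
  assume t: "0 \<le> t"
  let ?n = "nat \<lceil>q\<rceil>"
  have "t powr q \<le> 1 + t ^ ?n"
  proof (cases "t \<le> 1")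
    case True
    then have "t powr q \<le> 1" using t by (intro powr_le1 assms) auto
    moreover have "0 \<le> t ^ ?n" using t by simp
    ultimately show ?thesis by linarith
  next
    case False
    then have "t powr q \<le> t powr real ?n"
      by (intro powr_mono) linarith+
    then show ?thesis using False by (simp add: powr_realpow)
  qed
  also have "\<dots> \<le> (1 + fact ?n) * exp t"
    using power_le_fact_exp[OF t, of ?n] one_le_exp_iff[of t] t
    unfolding distrib_right by linarith
  finally show "t powr q \<le> (1 + fact (nat \<lceil>q\<rceil>)) * exp t" .
qed

subsection \<open>The Green function and its susceptibility\<close>

context
  fixes f :: "int ^ 'd::finite \<Rightarrow> real" and a z :: real
  assumes f: "\<And>x. 0 \<le> f x" "(f has_sum a) UNIV" and z: "0 \<le> z" "z * a < 1"
begin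

text \<open>Summed over \<open>x\<close>, the \<open>n\<close>-th layer has mass
  \<open>(z * a) ^ n\<close>, a convergent geometric series. The mass \<open>a\<close> is left
  general so that the results apply to \<open>D\<close>, where it is 1, and to its tilts.\<close>

lemma summable_on_green_terms:
  "(\<lambda>(n, x). z ^ n * convol_pow f n x) summable_on UNIV \<times> UNIV"
proof (rule summable_on_SigmaI[where g = "\<lambda>n. z ^ n * a ^ n"])
  have "0 \<le> a" using f by (intro has_sum_nonneg[OF f(2)]) auto
  then have "summable (\<lambda>n. (z * a) ^ n)"
    using z by (intro summable_geometric) simp
  then show "(\<lambda>n. z ^ n * a ^ n) summable_on UNIV"
    using z \<open>0 \<le> a\<close> by (subst summable_on_UNIV_nonneg_real_iff) (auto simp: power_mult_distrib)
  show "((\<lambda>x. (case (n, x) of (n, x) \<Rightarrow> z ^ n * convol_pow f n x)) has_sum z ^ n * a ^ n) UNIV" for n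
    unfolding prod.case by (intro has_sum_cmult_right has_sum_convol_pow f)
qed (use z f(1) in \<open>simp add: convol_pow_nonneg\<close>)

lemma has_sum_green: "((\<lambda>n. z ^ n * convol_pow f n x) has_sum green f z x) UNIV"
proof -
  have "(\<lambda>(x, n). z ^ n * convol_pow f n x) summable_on UNIV \<times> UNIV"
    using summable_on_green_terms by (subst summable_on_swap) simp
  then have "(\<lambda>n. z ^ n * convol_pow f n x) summable_on UNIV"
    by (drule_tac summable_on_SigmaD1[where x = x]) auto
  then obtain s where s: "((\<lambda>n. z ^ n * convol_pow f n x) has_sum s) UNIV"
    by (auto simp: summable_on_def)
  moreover have "s = green f z x"
    unfolding green_def using has_sum_imp_sums[OF s] by (rule sums_unique)
  ultimately show ?thesis by simp
qed

lemma green_nonneg: "0 \<le> green f z x"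
  by (rule has_sum_nonneg[OF has_sum_green]) (use z f in \<open>simp add: convol_pow_nonneg\<close>)

lemma summable_on_green: "green f z summable_on UNIV"
proof -
  have "(\<lambda>(x, n). z ^ n * convol_pow f n x) summable_on UNIV \<times> UNIV"
    using summable_on_green_terms by (subst summable_on_swap) simp
  then have "((\<lambda>(x, n). z ^ n * convol_pow f n x) has_sum
      (\<Sum>\<^sub>\<infinity>(x, n). z ^ n * convol_pow f n x)) (UNIV \<times> UNIV)"
    by simp
  then have "(green f z has_sum (\<Sum>\<^sub>\<infinity>(x, n). z ^ n * convol_pow f n x)) UNIV"
    by (rule has_sum_SigmaD) (use has_sum_green in auto)
  then show ?thesis by (rule has_sum_imp_summable)
qed

text \<open>Convolving with \<open>f\<close> termwise raises each convolution power by one; together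
  with the factor \<open>z\<close> this shifts the series by one index, and the missing zeroth term
  is \<open>delta0\<close>.\<close>

lemma green_renewal: "green f z x = delta0 x + z * convol f (green f z) x"
proof -
  \<comment> \<open>A single value is at most the total mass. This dominates the double series below
    by \<open>a\<close> times the Green terms, which justifies the exchange of sums.\<close>
  have f_le: "f x \<le> a" for x
    using finite_sum_le_has_sum[OF f(2), of "{x}"] f(1) by simp
  let ?F = "\<lambda>n y. f (x - y) * (z ^ n * convol_pow f n y)"
  have "(\<lambda>(n, y). a * (z ^ n * convol_pow f n y)) summable_on UNIV \<times> UNIV"
    using summable_on_cmult_right[OF summable_on_green_terms, of a] by (simp add: case_prod_unfold)
  then have joint: "(\<lambda>(n, y). ?F n y) summable_on UNIV \<times> UNIV"
    by (rule summable_on_comparison_test)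
      (use z f f_le in \<open>auto intro!: mult_right_mono simp: convol_pow_nonneg\<close>)
  have "(\<Sum>\<^sub>\<infinity>n. \<Sum>\<^sub>\<infinity>y. ?F n y) = (\<Sum>\<^sub>\<infinity>y. \<Sum>\<^sub>\<infinity>n. ?F n y)"
    by (rule infsum_swap_banach[OF joint])
  also have "\<dots> = convol f (green f z) x"
    unfolding convol_def by (simp add: infsum_cmult_right' infsumI[OF has_sum_green])
  finally have swap: "(\<Sum>\<^sub>\<infinity>n. \<Sum>\<^sub>\<infinity>y. ?F n y) = convol f (green f z) x" .
  have step: "(\<Sum>\<^sub>\<infinity>y. ?F n y) = z ^ n * convol_pow f (Suc n) x" for n
    by (simp add: convol_def mult.left_commute infsum_cmult_right')
  have "(\<lambda>n. \<Sum>\<^sub>\<infinity>y. ?F n y) summable_on UNIV"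
    using summable_on_Sigma_banach[OF joint] by simp
  then have "((\<lambda>n. z ^ n * convol_pow f (Suc n) x) has_sum convol f (green f z) x) UNIV"
    unfolding step swap[symmetric] by simp
  then have "(\<lambda>n. z ^ n * convol_pow f (Suc n) x) sums convol f (green f z) x"
    by (rule has_sum_imp_sums)
  then have "(\<lambda>n. z ^ Suc n * convol_pow f (Suc n) x) sums (z * convol f (green f z) x)"
    using sums_mult[of _ _ z] by (simp add: mult.assoc)
  then have "(\<lambda>n. z ^ n * convol_pow f n x) sums (z * convol f (green f z) x + delta0 x)"
    by (subst (asm) sums_Suc_iff) simp
  then show ?thesis
    unfolding green_def using sums_unique by fastforce
qed

end

lemma tilt_green:
  fixes D :: "int ^ 'd::finite \<Rightarrow> real"
  assumes "\<And>x. 0 \<le> D x" "(D has_sum 1) UNIV" "0 \<le> z" "z < 1"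
  shows "tilt \<mu> (green D z) = green (tilt \<mu> D) z"
proof
  fix x
  have "(\<lambda>n. z ^ n * convol_pow D n x) sums green D z x"
    by (intro has_sum_imp_sums has_sum_green[of D 1]) (use assms in auto)
  then have "(\<lambda>n. z ^ n * tilt \<mu> (convol_pow D n) x) sums tilt \<mu> (green D z) x"
    unfolding tilt_def using sums_mult2 by (fastforce simp: mult.assoc)
  then show "tilt \<mu> (green D z) x = green (tilt \<mu> D) z x"
    unfolding green_def by (simp add: tilt_convol_pow sums_iff)
qed

text \<open>If \<open>z * \<phi> < 1\<close>, the tilted series is geometric in total mass.
  Conversely, a finite mass \<open>X \<ge> 0\<close> satisfies the summed renewal equation
  \<open>X = 1 + z * \<phi> * X\<close>, impossible when \<open>z * \<phi> \<ge> 1\<close>.\<close>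

lemma mem_Omega_green_iff:
  fixes D :: "int ^ 'd::finite \<Rightarrow> real"
  assumes D: "\<And>x. 0 \<le> D x" "(D has_sum 1) UNIV" and z: "0 \<le> z" "z < 1"
    and \<phi>: "(tilt \<mu> D has_sum \<phi>) UNIV"
  shows "\<mu> \<in> Omega (green D z) \<longleftrightarrow> z * \<phi> < 1"
proof -
  let ?S = "green D z"
  have S: "0 \<le> ?S x" for x by (rule green_nonneg[of D 1]) (use D z in auto)
  have tD: "0 \<le> tilt \<mu> D x" for x by (simp add: D tilt_nonneg)
  have "tilt \<mu> ?S summable_on UNIV" if "z * \<phi> < 1"
    unfolding tilt_green[OF D z]
    by (rule summable_on_green[OF tD \<phi> z(1) that])
  moreover have "z * \<phi> < 1" if "tilt \<mu> ?S summable_on UNIV"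
  proof -
    from that obtain X where X: "(tilt \<mu> ?S has_sum X) UNIV"
      by (auto simp: summable_on_def)
    have X0: "0 \<le> X" using X by (rule has_sum_nonneg) (simp add: S tilt_nonneg)
    have ren: "?S x = delta0 x + z * convol D ?S x" for x
      by (rule green_renewal[of D 1]) (use D z in auto)
    have "tilt \<mu> ?S x = tilt \<mu> delta0 x + z * tilt \<mu> (convol D ?S) x" for x
      unfolding tilt_def by (subst ren) (simp add: algebra_simps)
    then have eq: "tilt \<mu> ?S x = delta0 x + z * convol (tilt \<mu> D) (tilt \<mu> ?S) x" for x
      by (simp add: tilt_convol)
    have "((\<lambda>x. delta0 x + z * convol (tilt \<mu> D) (tilt \<mu> ?S) x) has_sum
        (1 + z * (\<phi> * X))) UNIV"
      by (intro has_sum_add has_sum_delta0 has_sum_cmult_right has_sum_convol tD \<phi> X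
          tilt_nonneg S)
    then have "(tilt \<mu> ?S has_sum (1 + z * (\<phi> * X))) UNIV"
      by (rule has_sum_cong[OF eq, THEN iffD2])
    then have "X = 1 + (z * \<phi>) * X"
      unfolding mult.assoc by (rule has_sum_unique[OF X])
    then have "\<not> 1 * X \<le> (z * \<phi>) * X" by linarith
    then show ?thesis using mult_right_mono[OF _ X0, of 1 "z * \<phi>"] by linarith
  qed
  ultimately show ?thesis
    unfolding Omega_def mem_Collect_eq chi_finite_iff[OF S] by blast
qed

text \<open>Each summand is convex in \<open>\<mu>\<close> because \<open>exp\<close> is and the
  weights are nonnegative; convexity survives summation and gives continuity in finite
  dimension.\<close>

lemma continuous_on_tilt_sum:
  fixes D :: "int ^ 'd::finite \<Rightarrow> real"
  assumes "\<And>x. 0 \<le> D x" and summable: "\<And>\<mu>. tilt \<mu> D summable_on UNIV"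
  shows "continuous_on UNIV (\<lambda>\<mu>. infsum (tilt \<mu> D) UNIV)"
proof (rule convex_on_continuous[OF open_UNIV], rule convex_onI)
  fix t :: real and \<mu> \<nu> :: "real ^ 'd"
  assume t: "0 < t" "t < 1"
  have "tilt ((1 - t) *\<^sub>R \<mu> + t *\<^sub>R \<nu>) D x \<le> (1 - t) * tilt \<mu> D x + t * tilt \<nu> D x" for x
  proof -
    have "exp ((1 - t) *\<^sub>R (\<mu> \<bullet> lat x) + t *\<^sub>R (\<nu> \<bullet> lat x))
        \<le> (1 - t) * exp (\<mu> \<bullet> lat x) + t * exp (\<nu> \<bullet> lat x)"
      using t by (intro convex_onD[OF exp_convex]) auto
    from mult_left_mono[OF this assms(1)[of x]] show ?thesis
      by (simp add: tilt_def inner_add_left algebra_simps)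
  qed
  then have "infsum (tilt ((1 - t) *\<^sub>R \<mu> + t *\<^sub>R \<nu>) D) UNIV
      \<le> (\<Sum>\<^sub>\<infinity>x. (1 - t) * tilt \<mu> D x + t * tilt \<nu> D x)"
    by (intro infsum_mono summable summable_on_add summable_on_cmult_right)
  also have "\<dots> = (1 - t) * infsum (tilt \<mu> D) UNIV + t * infsum (tilt \<nu> D) UNIV"
    by (simp add: infsum_add summable summable_on_cmult_right infsum_cmult_right)
  finally show "infsum (tilt ((1 - t) *\<^sub>R \<mu> + t *\<^sub>R \<nu>) D) UNIV
      \<le> (1 - t) * infsum (tilt \<mu> D) UNIV + t * infsum (tilt \<nu> D) UNIV" .
qed auto

subsection \<open>Infrared bound and coercivity\<close>

text \<open>Jordan's inequality: by concavity on \<open>{0..pi}\<close>, sine lies above its chord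
  from 0 to \<open>pi / 2\<close>, where \<open>2 / pi * \<bar>y\<bar>\<close> is the interpolation
  parameter.\<close>

lemma abs_sin_ge:
  fixes y :: real
  assumes "\<bar>y\<bar> \<le> pi / 2"
  shows "2 / pi * \<bar>y\<bar> \<le> \<bar>sin y\<bar>"
proof -
  have "convex_on {0..pi} (\<lambda>x. - sin x :: real)"
    by (rule f''_ge0_imp_convex[where f' = "\<lambda>x. - cos x" and f'' = sin])
      (auto intro!: derivative_eq_intros sin_ge_zero)
  moreover have "2 / pi * \<bar>y\<bar> \<le> 1" using assms by (simp add: field_simps)
  ultimately have "- sin ((1 - 2 / pi * \<bar>y\<bar>) *\<^sub>R 0 + (2 / pi * \<bar>y\<bar>) *\<^sub>R (pi / 2))
      \<le> (1 - 2 / pi * \<bar>y\<bar>) * - sin 0 + 2 / pi * \<bar>y\<bar> * - sin (pi / 2)"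
    by (intro convex_onD[where A = "{0..pi}"]) auto
  then have "2 / pi * \<bar>y\<bar> \<le> sin \<bar>y\<bar>" by simp
  also have "\<dots> \<le> \<bar>sin y\<bar>" by (cases "0 \<le> y") auto
  finally show ?thesis .
qed

lemma summable_on_one_minus_cos:
  fixes w :: "int ^ 'd::finite \<Rightarrow> real"
  assumes "\<And>x. 0 \<le> w x" and "w summable_on UNIV"
  shows "(\<lambda>x. w x * (1 - cos (k \<bullet> lat x))) summable_on UNIV"
proof (rule summable_on_comparison_test)
  show "(\<lambda>x. w x * 2) summable_on UNIV" by (intro summable_on_cmult_left assms(2))
  show "w x * (1 - cos (k \<bullet> lat x)) \<le> w x * 2" for x
    using cos_ge_minus_one[of "k \<bullet> lat x"] by (intro mult_left_mono assms(1)) linarith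
qed (intro mult_nonneg_nonneg assms(1), simp)

lemma infrared_bound:
  fixes w :: "int ^ 'd::finite \<Rightarrow> real"
  assumes w: "\<And>x. 0 \<le> w x" "w summable_on UNIV"
    and support: "\<not> supported_on_proper_sublattice w"
  obtains c where "0 < c" "\<And>k. (\<And>i. \<bar>k $ i\<bar> \<le> pi) \<Longrightarrow>
    c * (norm k)\<^sup>2 \<le> (\<Sum>\<^sub>\<infinity>x. w x * (1 - cos (k \<bullet> lat x)))"
proof -
  define G where "G = (\<lambda>k. \<Sum>\<^sub>\<infinity>x. w x * (1 - cos (k \<bullet> lat x)))"
  have G_nonneg: "0 \<le> G k" for k
    unfolding G_def using w(1) by (intro infsum_nonneg mult_nonneg_nonneg) auto
  have half_angle: "1 - cos t = 2 * (sin (t / 2))\<^sup>2" for t :: real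
    using cos_double_sin[of "t / 2"] by simp
  \<comment> \<open>The constant \<open>C\<close> may depend on \<open>x\<close> but not on
    \<open>k\<close>; under subtraction of lattice points the constants add.\<close>
  define L where "L = {x. \<exists>C\<ge>0. \<forall>k. \<bar>sin (k \<bullet> lat x / 2)\<bar> \<le> C * sqrt (G k)}"
  have "sublattice L"
    unfolding sublattice_def
  proof (intro conjI ballI)
    show "0 \<in> L" using G_nonneg by (auto simp: L_def lat_simps intro: exI[of _ 0])
    fix x y
    assume "x \<in> L" "y \<in> L"
    then obtain A B where AB: "0 \<le> A" "0 \<le> B"
      "\<And>k. \<bar>sin (k \<bullet> lat x / 2)\<bar> \<le> A * sqrt (G k)" "\<And>k. \<bar>sin (k \<bullet> lat y / 2)\<bar> \<le> B * sqrt (G k)"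
      unfolding L_def by auto
    have sin_diff_le: "\<bar>sin (s - t)\<bar> \<le> \<bar>sin s\<bar> + \<bar>sin t\<bar>" for s t :: real
    proof -
      have "\<bar>sin (s - t)\<bar> \<le> \<bar>sin s\<bar> * \<bar>cos t\<bar> + \<bar>cos s\<bar> * \<bar>sin t\<bar>"
        unfolding sin_diff abs_mult[symmetric] by (rule abs_triangle_ineq4)
      also have "\<dots> \<le> \<bar>sin s\<bar> + \<bar>sin t\<bar>"
        by (intro add_mono mult_left_le mult_right_le_one_le mult_left_le_one_le) auto
      finally show ?thesis .
    qed
    have "\<bar>sin (k \<bullet> lat (x - y) / 2)\<bar> \<le> (A + B) * sqrt (G k)" for k
      using sin_diff_le[of "k \<bullet> lat x / 2" "k \<bullet> lat y / 2"] AB(3,4)[of k]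
      by (simp add: lat_simps inner_diff_right diff_divide_distrib distrib_right)
    then show "x - y \<in> L" using AB(1,2) unfolding L_def
      by (intro CollectI exI[of _ "A + B"]) auto
  qed
  moreover have "x \<in> L" if "w x \<noteq> 0" for x
  proof -
    have wx: "0 < w x" using w(1)[of x] that by simp
    \<comment> \<open>The single term at \<open>x\<close> in \<open>G k\<close> equals
      \<open>2 * w x\<close> times the squared sine, and all other terms are nonnegative.\<close>
    have "\<bar>sin (k \<bullet> lat x / 2)\<bar> \<le> sqrt (1 / (2 * w x)) * sqrt (G k)" for k
    proof -
      have "(\<Sum>y\<in>{x}. w y * (1 - cos (k \<bullet> lat y))) \<le> G k"
        unfolding G_def using w
        by (intro finite_sum_le_infsum summable_on_one_minus_cos) auto
      then have "(sin (k \<bullet> lat x / 2))\<^sup>2 \<le> 1 / (2 * w x) * G k"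
        unfolding half_angle using wx by (simp add: field_simps)
      then have "sqrt ((sin (k \<bullet> lat x / 2))\<^sup>2) \<le> sqrt (1 / (2 * w x) * G k)"
        by (rule real_sqrt_le_mono)
      then show ?thesis by (simp only: real_sqrt_abs real_sqrt_mult)
    qed
    then show ?thesis unfolding L_def using wx
      by (intro CollectI exI[of _ "sqrt (1 / (2 * w x))"]) auto
  qed
  ultimately have "L = UNIV"
    using support unfolding supported_on_proper_sublattice_def by blast
  then have "axis i 1 \<in> L" for i by simp
  then have "\<exists>C\<ge>0. \<forall>k. \<bar>sin (k $ i / 2)\<bar> \<le> C * sqrt (G k)" for i
  proof -
    have "k \<bullet> lat (axis i 1) = k $ i" for k
    proof -
      have "lat (axis i 1) = axis i 1" by (auto simp: lat_def axis_def vec_eq_iff)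
      then show ?thesis by (simp add: inner_axis)
    qed
    with \<open>axis i 1 \<in> L\<close> show ?thesis by (simp add: L_def)
  qed
  then obtain C where C: "\<And>i. 0 \<le> C i" "\<And>i k. \<bar>sin (k $ i / 2)\<bar> \<le> C i * sqrt (G k)"
    by metis
  define B where "B = (\<Sum>i\<in>UNIV. (pi * C i)\<^sup>2)"
  have B: "0 \<le> B" by (simp add: B_def sum_nonneg)
  have "1 / (B + 1) * (norm k)\<^sup>2 \<le> G k" if k: "\<And>i. \<bar>k $ i\<bar> \<le> pi" for k
  proof -
    have "(k $ i)\<^sup>2 \<le> (pi * C i)\<^sup>2 * G k" for i
    proof -
      \<comment> \<open>Restricting \<open>k\<close> to the period box puts the half-angle in the
        range of Jordan's inequality.\<close>
      have "2 / pi * \<bar>k $ i / 2\<bar> \<le> C i * sqrt (G k)"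
        using abs_sin_ge[of "k $ i / 2"] k[of i] C(2)[of k i] by simp
      then have "\<bar>k $ i\<bar> \<le> pi * C i * sqrt (G k)" by (simp add: field_simps)
      then have "\<bar>k $ i\<bar>\<^sup>2 \<le> (pi * C i * sqrt (G k))\<^sup>2"
        by (intro power_mono) auto
      then show ?thesis using G_nonneg[of k] by (simp add: power_mult_distrib)
    qed
    then have "(\<Sum>i\<in>UNIV. (k $ i)\<^sup>2) \<le> B * G k"
      unfolding B_def sum_distrib_right by (rule sum_mono)
    moreover have "(norm k)\<^sup>2 = (\<Sum>i\<in>UNIV. (k $ i)\<^sup>2)"
      by (simp only: power2_norm_eq_inner inner_vec_def) (simp add: power2_eq_square)
    ultimately have "(norm k)\<^sup>2 \<le> (B + 1) * G k"
      using G_nonneg[of k] by (simp add: distrib_right)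
    then show ?thesis using B by (simp add: field_simps)
  qed
  then have "1 / (B + 1) * (norm k)\<^sup>2 \<le> (\<Sum>\<^sub>\<infinity>x. w x * (1 - cos (k \<bullet> lat x)))"
    if "\<And>i. \<bar>k $ i\<bar> \<le> pi" for k
    using that unfolding G_def .
  moreover have "0 < 1 / (B + 1)" using B by simp
  ultimately show thesis by (rule that[rotated])
qed

section \<open>Real parts of Fourier transforms\<close>

lemma Re_fourier:
  fixes f :: "int ^ 'd::finite \<Rightarrow> real"
  assumes "f summable_on UNIV"
  shows "((\<lambda>x. f x * cos (k \<bullet> lat x)) has_sum Re (fourier f k)) UNIV"
proof -
  let ?g = "\<lambda>x. complex_of_real (f x) * exp (- (\<i> * complex_of_real (k \<bullet> lat x)))"
  have norm_eq: "norm (?g x) = norm (f x)" for x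
    by (simp add: norm_mult)
  have "?g summable_on UNIV"
    by (rule abs_summable_summable, unfold norm_eq)
      (rule summable_on_iff_abs_summable_on_real[THEN iffD1, OF assms])
  then have "(?g has_sum fourier f k) UNIV"
    unfolding fourier_def by (rule has_sum_infsum)
  from has_sum_Re[OF this] show ?thesis
    by (simp add: Re_exp)
qed

lemma Re_fourier_diff:
  fixes f :: "int ^ 'd::finite \<Rightarrow> real"
  assumes "f summable_on UNIV"
  shows "Re (fourier f 0 - fourier f k) = (\<Sum>\<^sub>\<infinity>x. f x * (1 - cos (k \<bullet> lat x)))"
proof -
  have "((\<lambda>x. f x * cos (0 \<bullet> lat x) + - (f x * cos (k \<bullet> lat x))) has_sum
      (Re (fourier f 0) + - Re (fourier f k))) UNIV"
    by (intro has_sum_add has_sum_uminusI Re_fourier assms)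
  from infsumI[OF this] show ?thesis
    by (simp add: right_diff_distrib)
qed

section \<open>Coercivity of the tilted mass\<close>

lemma lat_symmetric_flip:
  fixes f :: "int ^ 'd::finite \<Rightarrow> real"
  assumes "lat_symmetric f"
  shows "f (\<chi> j. if j \<in> A then - (x $ j) else x $ j) = f x"
proof (induction A rule: finite_induct[OF finite])
  case 1
  then show ?case by simp
next
  case (2 i A)
  let ?y = "\<chi> j. if j \<in> A then - (x $ j) else x $ j"
  have "(\<chi> j. if j \<in> insert i A then - (x $ j) else x $ j)
      = (\<chi> j. if j = i then - (?y $ j) else ?y $ j)"
    using 2(2) by (auto simp: vec_eq_iff)
  then have "f (\<chi> j. if j \<in> insert i A then - (x $ j) else x $ j)
      = f (\<chi> j. if j = i then - (?y $ j) else ?y $ j)"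
    by (rule arg_cong)
  also have "\<dots> = f ?y"
    by (rule spec[OF spec[OF conjunct1[OF assms[unfolded lat_symmetric_def]], of ?y], of i])
  also have "\<dots> = f x" by (rule 2(3))
  finally show ?case .
qed

lemma tilt_sum_coercive:
  fixes D :: "int ^ 'd::finite \<Rightarrow> real"
  assumes D: "\<And>x. 0 \<le> D x" "lat_symmetric D" "\<not> supported_on_proper_sublattice D"
    and summable: "\<And>\<mu>. tilt \<mu> D summable_on UNIV"
  obtains R where "\<And>\<mu>. infsum (tilt \<mu> D) UNIV \<le> B \<Longrightarrow> norm \<mu> \<le> R"
proof -
  \<comment> \<open>Otherwise the support would lie in the coordinate hyperplane
    \<open>x $ i = 0\<close>, a proper sublattice.\<close>
  have "\<exists>x. D x \<noteq> 0 \<and> x $ i \<noteq> 0" for i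
  proof (rule ccontr)
    assume "\<nexists>x. D x \<noteq> 0 \<and> x $ i \<noteq> 0"
    moreover have "sublattice {x :: int ^ 'd. x $ i = 0}"
      by (simp add: sublattice_def)
    moreover have "{x :: int ^ 'd. x $ i = 0} \<noteq> UNIV"
    proof -
      have "axis i 1 \<notin> {x :: int ^ 'd. x $ i = 0}" by (simp add: axis_def)
      then show ?thesis by blast
    qed
    ultimately show False
      using D(3) unfolding supported_on_proper_sublattice_def by blast
  qed
  then obtain X where X: "\<And>i. D (X i) \<noteq> 0" "\<And>i. X i $ i \<noteq> 0" by metis
  have DX: "0 < D (X i)" for i using D(1)[of "X i"] X(1)[of i] by simp
  have "norm \<mu> \<le> (\<Sum>i\<in>UNIV. ln (B / D (X i)))" if \<mu>: "infsum (tilt \<mu> D) UNIV \<le> B" for \<mu>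
  proof -
    have "\<bar>\<mu> $ i\<bar> \<le> ln (B / D (X i))" for i
    proof -
      \<comment> \<open>Reflected so that every product \<open>\<mu> $ j * y $ j\<close> is
        nonnegative; no cancellation can then occur in \<open>\<mu> \<bullet> lat y\<close>.\<close>
      define y where "y = (\<chi> j. if j \<in> {j. \<mu> $ j * X i $ j < 0} then - (X i $ j) else X i $ j)"
      \<comment> \<open>A nonzero integer coordinate has absolute value at least 1.\<close>
      have "\<bar>\<mu> $ i\<bar> * 1 \<le> \<bar>\<mu> $ i\<bar> * \<bar>real_of_int (X i $ i)\<bar>"
        using X(2)[of i] by (intro mult_left_mono) linarith+
      also have "\<dots> \<le> (\<Sum>j\<in>UNIV. \<bar>\<mu> $ j\<bar> * \<bar>real_of_int (X i $ j)\<bar>)"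
        by (intro member_le_sum) auto
      also have "\<dots> = \<mu> \<bullet> lat y"
        by (auto simp: inner_vec_def lat_def y_def abs_mult[symmetric] intro!: sum.cong)
      finally have "D y * exp \<bar>\<mu> $ i\<bar> \<le> tilt \<mu> D y"
        unfolding tilt_def by (intro mult_left_mono D) simp
      also have "\<dots> = (\<Sum>x\<in>{y}. tilt \<mu> D x)" by simp
      also have "\<dots> \<le> infsum (tilt \<mu> D) UNIV"
        by (intro finite_sum_le_infsum summable) (auto intro: tilt_nonneg D)
      also have "D y = D (X i)"
        unfolding y_def by (rule lat_symmetric_flip[OF D(2)])
      finally have "D (X i) * exp \<bar>\<mu> $ i\<bar> \<le> B" using \<mu> by simp
      then have "exp \<bar>\<mu> $ i\<bar> \<le> B / D (X i)"
        using DX[of i] by (simp add: field_simps)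
      then show ?thesis
        by (meson exp_gt_zero less_le_trans ln_ge_iff)
    qed
    then show ?thesis
      by (intro order_trans[OF norm_le_l1_cart] sum_mono)
  qed
  then show thesis by (rule that)
qed

subsection \<open>Membership in the class\<close>

lemma lp_norm_le_delta0: "lp_norm_le 1 (delta0 :: int ^ 'd::finite \<Rightarrow> real) 1"
  using has_sum_imp_summable[OF has_sum_delta0[where 'd = 'd]]
    infsumI[OF has_sum_delta0[where 'd = 'd]]
  by (simp add: lp_norm_le_def in_lp_def lp_norm_def delta0_nonneg)

lemma Re_fourier_delta0: "Re (fourier delta0 (0 :: real ^ 'd::finite)) = 1"
proof (rule has_sum_unique)
  show "((delta0 :: int ^ 'd \<Rightarrow> real) has_sum Re (fourier delta0 (0 :: real ^ 'd))) UNIV"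
    using Re_fourier[OF has_sum_imp_summable[OF has_sum_delta0], of "0 :: real ^ 'd"] by simp
qed (rule has_sum_delta0)

lemma tilt_class_Q:
  fixes D :: "int ^ 'd::finite \<Rightarrow> real"
  assumes decay: "superexp_decay D" and D: "\<And>x. 0 \<le> D x \<and> D x \<le> 1"
    and support: "\<not> supported_on_proper_sublattice D"
    and "0 < \<epsilon>" and "0 < \<zeta>"
  obtains M K where "0 < M" "0 < K"
    "\<And>z \<mu>. \<epsilon> \<le> z \<Longrightarrow> z \<le> 1 \<Longrightarrow> norm \<mu> \<le> R \<Longrightarrow>
      ((\<lambda>x. z * tilt \<mu> D x), tilt \<mu> delta0) \<in> class_Q M K \<zeta>"
proof -
  define p where "p = min (real CARD('d) / 3) 2"
  have "0 < p" by (simp add: p_def)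
  obtain A where A: "\<And>t. 0 \<le> t \<Longrightarrow> t powr (2 + \<zeta>) \<le> A * exp t"
    using powr_le_exp[of "2 + \<zeta>"] \<open>0 < \<zeta>\<close> by auto
  obtain M1 where M1: "\<And>z \<mu>. 0 \<le> z \<Longrightarrow> z \<le> 1 \<Longrightarrow> norm \<mu> \<le> R \<Longrightarrow>
      lp_norm_le 1 (\<lambda>x. 1 * (z * tilt \<mu> D x)) M1"
    by (rule tilt_weighted_bound[OF decay D, of 1 "\<lambda>_. 1" 1 R]) auto
  obtain M2 where M2: "\<And>z \<mu>. 0 \<le> z \<Longrightarrow> z \<le> 1 \<Longrightarrow> norm \<mu> \<le> R \<Longrightarrow>
      lp_norm_le 1 (\<lambda>x. lnorm x powr (2 + \<zeta>) * (z * tilt \<mu> D x)) M2"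
    by (rule tilt_weighted_bound[OF decay D, of 1 "\<lambda>x. lnorm x powr (2 + \<zeta>)" A R])
      (auto simp: A)
  obtain M3 where M3: "\<And>z \<mu>. 0 \<le> z \<Longrightarrow> z \<le> 1 \<Longrightarrow> norm \<mu> \<le> R \<Longrightarrow>
      lp_norm_le p (\<lambda>x. lnorm x ^ (CARD('d) - 1) * (z * tilt \<mu> D x)) M3"
    by (rule tilt_weighted_bound[OF decay D \<open>0 < p\<close>,
          of "\<lambda>x. lnorm x ^ (CARD('d) - 1)" "fact (CARD('d) - 1)" R])
      (auto simp: power_le_fact_exp)
  \<comment> \<open>The 1 accounts for the l1 norm of \<open>delta0\<close>.\<close>
  define M where "M = max 1 (max M1 (max M2 M3))"
  have M: "0 \<le> M" "1 \<le> M" "M1 \<le> M" "M2 \<le> M" "M3 \<le> M" by (auto simp: M_def)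

  \<comment> \<open>A common lower bound for all tilts in the ball, with the same support as
    \<open>D\<close>; one infrared constant \<open>c\<close> then works for every
    \<open>\<mu>\<close>.\<close>
  define w where "w = (\<lambda>x. D x * exp (- \<bar>R\<bar> * lnorm x))"
  have w_nonneg: "0 \<le> w x" for x by (simp add: w_def D)
  have w_le: "w x \<le> tilt \<mu> D x" if "norm \<mu> \<le> \<bar>R\<bar>" for \<mu> x
    unfolding w_def tilt_def using that D by (intro mult_left_mono tilt_exp_bound) auto
  have tilt_summable: "tilt \<mu> D summable_on UNIV" for \<mu>
    by (rule summable_on_tilt[OF decay D])
  have w_summable: "w summable_on UNIV"
    by (rule summable_on_comparison_test[OF tilt_summable[of 0]]) (use w_nonneg w_le in auto)
  have "{x. w x \<noteq> 0} = {x. D x \<noteq> 0}" by (simp add: w_def)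
  then have "\<not> supported_on_proper_sublattice w"
    using support by (simp add: supported_on_proper_sublattice_def)
  then obtain c where c: "0 < c"
    "\<And>k. (\<And>i. \<bar>k $ i\<bar> \<le> pi) \<Longrightarrow> c * (norm k)\<^sup>2 \<le> (\<Sum>\<^sub>\<infinity>x. w x * (1 - cos (k \<bullet> lat x)))"
    by (rule infrared_bound[OF w_nonneg w_summable]) blast

  have Q: "((\<lambda>x. z * tilt \<mu> D x), tilt \<mu> delta0) \<in> class_Q M (\<epsilon> * c) \<zeta>"
    if z: "\<epsilon> \<le> z" "z \<le> 1" and \<mu>: "norm \<mu> \<le> R" for z \<mu>
  proof -
    let ?Q = "\<lambda>x. z * tilt \<mu> D x"
    have z0: "0 \<le> z" using z \<open>0 < \<epsilon>\<close> by simp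
    have Q_summable: "?Q summable_on UNIV"
      by (intro summable_on_cmult_right tilt_summable)
    have "\<epsilon> * c * (norm k)\<^sup>2 \<le> Re (fourier ?Q 0 - fourier ?Q k)"
      if k: "\<And>i. \<bar>k $ i\<bar> \<le> pi" for k
    proof -
      have "\<epsilon> * c * (norm k)\<^sup>2 \<le> \<epsilon> * (\<Sum>\<^sub>\<infinity>x. w x * (1 - cos (k \<bullet> lat x)))"
        using c(2)[OF k] \<open>0 < \<epsilon>\<close> by (simp add: mult.assoc)
      also have "\<dots> = (\<Sum>\<^sub>\<infinity>x. (\<epsilon> * w x) * (1 - cos (k \<bullet> lat x)))"
        by (simp add: mult.assoc infsum_cmult_right')
      \<comment> \<open>Since \<open>1 - cos\<close> is nonnegative, the pointwise bound
        \<open>\<epsilon> * w x \<le> z * tilt \<mu> D x\<close> carries over to the sums.\<close>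
      also have "\<dots> \<le> (\<Sum>\<^sub>\<infinity>x. ?Q x * (1 - cos (k \<bullet> lat x)))"
        using z0 z \<open>0 < \<epsilon>\<close> w_nonneg w_le[OF order_trans[OF \<mu> abs_ge_self]]
        by (intro infsum_mono summable_on_one_minus_cos Q_summable mult_right_mono mult_mono
            summable_on_cmult_right w_summable mult_nonneg_nonneg tilt_nonneg)
          (auto simp: D)
      also have "\<dots> = Re (fourier ?Q 0 - fourier ?Q k)"
        by (rule Re_fourier_diff[OF Q_summable, symmetric])
      finally show ?thesis .
    qed
    moreover have "(\<lambda>y :: int ^ 'd. lnorm y powr \<zeta> * delta0 y) = (\<lambda>_. 0)"
      "(\<lambda>y :: int ^ 'd. (lnorm y)\<^sup>2 * delta0 y) = (\<lambda>_. 0)"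
      by (auto simp: delta0_def)
    \<comment> \<open>The dimension condition makes the exponent positive; with exponent 0 the
      weight at the origin would be 1.\<close>
    moreover have "(\<lambda>y :: int ^ 'd. lnorm y ^ (CARD('d) - 1) * delta0 y) = (\<lambda>_. 0)"
      if "4 \<le> CARD('d)"
      using that by (auto simp: delta0_def)
    moreover have "lp_norm_le 1 ?Q M"
      using lp_norm_le_mono[OF M1[OF z0 z(2) \<mu>] M(3)] by simp
    moreover have "lp_norm_le 1 (\<lambda>y. lnorm y powr (2 + \<zeta>) * ?Q y) M"
      by (rule lp_norm_le_mono[OF M2[OF z0 z(2) \<mu>] M(4)])
    moreover have "lp_norm_le p (\<lambda>y. lnorm y ^ (CARD('d) - 1) * ?Q y) M"
      by (rule lp_norm_le_mono[OF M3[OF z0 z(2) \<mu>] M(5)])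
    moreover have "lp_norm_le 1 (delta0 :: int ^ 'd \<Rightarrow> real) M"
      by (rule lp_norm_le_mono[OF lp_norm_le_delta0 M(2)])
    ultimately show ?thesis
      using lp_norm_le_zero[OF M(1), where 'a = "int ^ 'd"] by (simp add: class_Q_def flip: p_def)
  qed
  show thesis
  proof (rule that[of M "\<epsilon> * c"])
    show "0 < M" "0 < \<epsilon> * c" using M(2) c(1) \<open>0 < \<epsilon>\<close> by auto
  qed (rule Q)
qed

theorem theorem3p2:
  fixes D :: "int ^ 'd::finite \<Rightarrow> real"
  assumes "prob_distribution D"
    and "lat_symmetric D"
    and "\<not> supported_on_proper_sublattice D"
    and "(\<lambda>x. (lnorm x)\<^sup>2 * D x) summable_on UNIV"
    and "superexp_decay D"
  shows "(\<forall>z\<in>{0<..<1}. assumption1 (green D z) \<and>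
            assumption2 (green D z) delta0 (\<lambda>x. z * D x)) \<and>
         (\<forall>\<epsilon>\<in>{0<..<1}. \<forall>\<zeta>>0. \<exists>M>0. \<exists>K>0. \<forall>z\<in>{\<epsilon>..<1}. \<forall>\<mu>\<in>closure (Omega (green D z)).
            ((\<lambda>x. z * tilt \<mu> D x), tilt \<mu> delta0) \<in> class_Q M K \<zeta>)"
proof -
  have D: "0 \<le> D x \<and> D x \<le> 1" for x
    using assms(1) by (simp add: prob_distribution_def)
  then have D0: "0 \<le> D x" for x by simp
  have D1: "(D has_sum 1) UNIV"
    using assms(1) by (simp add: prob_distribution_def)
  define \<phi> where "\<phi> = (\<lambda>\<mu>. infsum (tilt \<mu> D) UNIV)"
  have summable: "tilt \<mu> D summable_on UNIV" for \<mu>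
    by (rule summable_on_tilt[OF assms(5) D])
  have mem_Omega: "\<mu> \<in> Omega (green D z) \<longleftrightarrow> z * \<phi> \<mu> < 1" if "0 < z" "z < 1" for z \<mu>
    using that summable by (intro mem_Omega_green_iff[OF D0 D1]) (auto simp: \<phi>_def)
  \<comment> \<open>From \<open>z * \<phi> \<mu> < 1\<close> and \<open>z \<ge> \<epsilon>\<close>
    follows \<open>\<phi> \<mu> \<le> 1 / \<epsilon>\<close>, a sublevel set independent of
    \<open>z\<close> and bounded by coercivity.\<close>
  have Omega_bounded: "\<exists>R. \<forall>z\<in>{\<epsilon>..<1}. Omega (green D z) \<subseteq> cball 0 R" if "0 < \<epsilon>" for \<epsilon>
  proof -
    obtain R where R: "\<And>\<mu>. \<phi> \<mu> \<le> 1 / \<epsilon> \<Longrightarrow> norm \<mu> \<le> R"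
      using tilt_sum_coercive[OF D0 assms(2,3) summable, of "1 / \<epsilon>"] unfolding \<phi>_def by metis
    have "norm \<mu> \<le> R" if "z \<in> {\<epsilon>..<1}" "\<mu> \<in> Omega (green D z)" for z \<mu>
    proof (rule R)
      have "0 \<le> \<phi> \<mu>" unfolding \<phi>_def by (intro infsum_nonneg tilt_nonneg D0)
      then have "\<epsilon> * \<phi> \<mu> \<le> z * \<phi> \<mu>" using that by (intro mult_right_mono) auto
      also have "\<dots> \<le> 1" using that \<open>0 < \<epsilon>\<close> mem_Omega[of z \<mu>] by simp
      finally show "\<phi> \<mu> \<le> 1 / \<epsilon>" using \<open>0 < \<epsilon>\<close> by (simp add: field_simps)
    qed
    then show ?thesis by (intro exI[of _ R]) auto
  qed
  have uniform: "\<exists>M>0. \<exists>K>0. \<forall>z\<in>{\<epsilon>..<1}. \<forall>\<mu>\<in>closure (Omega (green D z)).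
      ((\<lambda>x. z * tilt \<mu> D x), tilt \<mu> delta0) \<in> class_Q M K \<zeta>"
    if pos: "0 < \<epsilon>" "0 < \<zeta>" for \<epsilon> \<zeta>
  proof -
    obtain R where R: "\<forall>z\<in>{\<epsilon>..<1}. Omega (green D z) \<subseteq> cball 0 R"
      using Omega_bounded[OF pos(1)] by blast
    obtain M K where "0 < M" "0 < K" and MK: "\<And>z \<mu>. \<epsilon> \<le> z \<Longrightarrow> z \<le> 1 \<Longrightarrow> norm \<mu> \<le> R \<Longrightarrow>
        ((\<lambda>x. z * tilt \<mu> D x), tilt \<mu> delta0) \<in> class_Q M K \<zeta>"
      by (rule tilt_class_Q[OF assms(5) D assms(3) pos]) blast
    \<comment> \<open>The ball is closed, so it also contains the closure of
      \<open>Omega\<close>.\<close>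
    have "norm \<mu> \<le> R" if "z \<in> {\<epsilon>..<1}" "\<mu> \<in> closure (Omega (green D z))" for z \<mu>
      using closure_minimal[OF bspec[OF R that(1)] closed_cball] that(2) by auto
    then show ?thesis
      using \<open>0 < M\<close> \<open>0 < K\<close> MK by (intro exI[of _ M] conjI exI[of _ K] ballI) auto
  qed
  have "assumption1 (green D z)" if z: "0 < z" "z < 1" for z
  proof -
    obtain R where R: "Omega (green D z) \<subseteq> cball 0 R"
      using Omega_bounded[OF z(1)] z by (meson atLeastLessThan_iff order_refl)
    have "axis i (\<bar>R\<bar> + 1) \<notin> Omega (green D z)" for i
    proof -
      have "axis i (\<bar>R\<bar> + 1) \<notin> cball (0 :: real ^ 'd) R"
        using component_le_norm_cart[of "axis i (\<bar>R\<bar> + 1) :: real ^ 'd" i] by simp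
      with R show ?thesis by blast
    qed
    moreover have "Omega (green D z) = {\<mu>. z * \<phi> \<mu> < 1}"
      using mem_Omega[OF z] by auto
    moreover have "open {\<mu>. z * \<phi> \<mu> < 1}"
      unfolding \<phi>_def
      by (intro open_Collect_less continuous_intros continuous_on_tilt_sum D0 summable)
    moreover have "\<phi> 0 = 1"
      unfolding \<phi>_def tilt_def by (simp add: infsumI[OF D1])
    moreover have "0 \<le> green D z x" for x
      by (rule green_nonneg[OF D0 D1]) (use z in auto)
    ultimately show ?thesis
      unfolding assumption1_def using z lat_symmetric_green[OF assms(2), of z]
      by (intro conjI exI[of _ "\<bar>R\<bar> + 1"]) simp_all
  qed
  moreover have "assumption2 (green D z) delta0 (\<lambda>x. z * D x)" if z: "0 < z" "z < 1" for z
  proof -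
    have "green D z x = delta0 x + convol (\<lambda>x. z * D x) (green D z) x" for x
      using green_renewal[OF D0 D1, of z x] z
      by (simp add: convol_def mult.assoc infsum_cmult_right')
    moreover have "lat_symmetric (\<lambda>x. z * D x)"
      by (rule lat_symmetric_transfer[OF assms(2,2)]) simp
    moreover have "in_lp 1 (\<lambda>x. z * D x)"
      using z D0 summable_on_cmult_right[OF has_sum_imp_summable[OF D1], of z]
      by (simp add: in_lp_def)
    moreover have "in_lp 1 (delta0 :: int ^ 'd \<Rightarrow> real)"
      using lp_norm_le_delta0[where 'd = 'd] by (simp add: lp_norm_le_def)
    moreover have tilt_eq: "tilt \<mu> (\<lambda>x. z * D x) = (\<lambda>x. z * tilt \<mu> D x)" for \<mu>
      by (simp add: tilt_cmult fun_eq_iff)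
    moreover have "\<exists>M>0. \<exists>K>0. \<exists>\<zeta>>0. \<forall>\<mu>\<in>closure (Omega (green D z)).
        (tilt \<mu> (\<lambda>x. z * D x), tilt \<mu> delta0) \<in> class_Q M K \<zeta> \<and>
        Re (fourier (tilt \<mu> delta0) 0) > 0"
    proof -
      \<comment> \<open>The uniform statement is specialised to \<open>\<epsilon> = z\<close> and
        \<open>\<zeta> = 1\<close>.\<close>
      obtain M K where "0 < M" "0 < K" and MK: "\<forall>z'\<in>{z..<1}. \<forall>\<mu>\<in>closure (Omega (green D z')).
          ((\<lambda>x. z' * tilt \<mu> D x), tilt \<mu> delta0) \<in> class_Q M K 1"
        using uniform[OF z(1) zero_less_one] by blast
      have "(tilt \<mu> (\<lambda>x. z * D x), tilt \<mu> delta0) \<in> class_Q M K 1 \<and>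
          Re (fourier (tilt \<mu> delta0) 0) > 0" if "\<mu> \<in> closure (Omega (green D z))" for \<mu>
        unfolding tilt_eq using MK that z by (simp add: Re_fourier_delta0)
      then show ?thesis
        using \<open>0 < M\<close> \<open>0 < K\<close> zero_less_one by blast
    qed
    ultimately show ?thesis
      unfolding assumption2_def using lat_symmetric_delta0 by blast
  qed
  ultimately show ?thesis
    by (intro conjI ballI allI impI uniform) auto
qed

end
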